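(* Let $n\ge 1$, let $f_i:\mathbb{R}^d\to\mathbb{R}$ be convex and $L_i$-smooth with $L_i>0$ for $i=1,\dots,n$, and let $\psi:\mathbb{R}^d\to\mathbb{R}\cup\{+\infty\}$ be proper, closed and convex. Let $f=\frac1n\sum_{i=1}^n f_i$, $L_{\max}=\max_{i} L_i$, and let $x_\ast$ be a solution of $\min_{x\in\mathbb{R}^d}\{f(x)+\psi(x)\}$. Then for every stepsize $\gamma>0$, with $\pi=(\pi_0,\dots,\pi_{n-1})$ a uniformly random permutation of $\{1,\dots,n\}$, the shuffling radius satisfies $$\sigma_{\mathrm{rad}}^2(\gamma)\le \frac{L_{\max}}{2}\,n\Bigl(n\|\nabla f(x_\ast)\|^2+\frac12\sigma_\ast^2\Bigr),\qquad \sigma_\ast^2:=\frac1n\sum_{i=1}^n\|\nabla f_i(x_\ast)-\nabla f(x_\ast)\|^2 .$$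
   Context: A differentiable function $\phi:\mathbb{R}^d\to\mathbb{R}$ has Bregman divergence $D_\phi(x,y)=\phi(x)-\phi(y)-\langle\nabla\phi(y),x-y\rangle$, and it is called $L$-smooth if it is continuously differentiable and $D_\phi(x,y)\le\frac L2\|x-y\|^2$ for all $x,y$. Given $\gamma>0$ and a permutation $\pi=(\pi_0,\dots,\pi_{n-1})$ of $\{1,\dots,n\}$, define $x_\ast^i=x_\ast-\gamma\sum_{j=0}^{i-1}\nabla f_{\pi_j}(x_\ast)$ for $i=1,\dots,n-1$. The shuffling radius is $$\sigma_{\mathrm{rad}}^2(\gamma)=\max_{i=1,\dots,n-1}\frac1{\gamma^2}\,\mathbb{E}_\pi\bigl[D_{f_{\pi_i}}(x_\ast^i,x_\ast)\bigr],$$ where the expectation is over the uniformly random permutation $\pi$ (a maximum over the empty set, when $n=1$, is $0$). *)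

theory Defs
  imports "HOL-Probability.Probability"
begin

(* The value is meaningful only where \<phi> is differentiable at x. *)
definition gradient :: "('a::euclidean_space \<Rightarrow> real) \<Rightarrow> 'a \<Rightarrow> 'a" where
  "gradient \<phi> x = (THE g. GDERIV \<phi> x :> g)"

definition bregman :: "('a::euclidean_space \<Rightarrow> real) \<Rightarrow> 'a \<Rightarrow> 'a \<Rightarrow> real" where
  "bregman \<phi> x y = \<phi> x - \<phi> y - gradient \<phi> y \<bullet> (x - y)"

definition L_smooth :: "real \<Rightarrow> ('a::euclidean_space \<Rightarrow> real) \<Rightarrow> bool" where
  "L_smooth L \<phi> \<longleftrightarrow>
     (\<forall>x. \<phi> differentiable (at x)) \<and> continuous_on UNIV (gradient \<phi>) \<and>
     (\<forall>x y. bregman \<phi> x y \<le> L / 2 * (norm (x - y))\<^sup>2)"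

(* Functions into the reals with +\<infinity> are ereal-valued and proper, which excludes -\<infinity>.
   The library's epigraph covers real-valued functions only. *)
definition proper_fun :: "('a::euclidean_space \<Rightarrow> ereal) \<Rightarrow> bool" where
  "proper_fun \<psi> \<longleftrightarrow> (\<forall>x. \<psi> x \<noteq> -\<infinity>) \<and> (\<exists>x. \<psi> x \<noteq> \<infinity>)"

definition ereal_epigraph :: "('a::euclidean_space \<Rightarrow> ereal) \<Rightarrow> ('a \<times> real) set" where
  "ereal_epigraph \<psi> = {(x, t). \<psi> x \<le> ereal t}"

definition closed_fun :: "('a::euclidean_space \<Rightarrow> ereal) \<Rightarrow> bool" where
  "closed_fun \<psi> \<longleftrightarrow> closed (ereal_epigraph \<psi>)"

definition convex_fun :: "('a::euclidean_space \<Rightarrow> ereal) \<Rightarrow> bool" where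
  "convex_fun \<psi> \<longleftrightarrow> convex (ereal_epigraph \<psi>)"

definition average_fun :: "nat \<Rightarrow> (nat \<Rightarrow> 'a::euclidean_space \<Rightarrow> real) \<Rightarrow> 'a \<Rightarrow> real" where
  "average_fun n f x = 1 / real n * (\<Sum>i=1..n. f i x)"

definition is_solution ::
    "('a::euclidean_space \<Rightarrow> real) \<Rightarrow> ('a \<Rightarrow> ereal) \<Rightarrow> 'a \<Rightarrow> bool" where
  "is_solution F \<psi> x \<longleftrightarrow> (\<forall>y. ereal (F x) + \<psi> x \<le> ereal (F y) + \<psi> y)"

(* A permutation of {1..n} is a list p with entries p ! 0, ..., p ! (n - 1). *)
definition x_iter ::
    "(nat \<Rightarrow> 'a::euclidean_space \<Rightarrow> real) \<Rightarrow> 'a \<Rightarrow> real \<Rightarrow> nat list \<Rightarrow> nat \<Rightarrow> 'a" where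
  "x_iter f xs \<gamma> p i = xs - \<gamma> *\<^sub>R (\<Sum>j<i. gradient (f (p ! j)) xs)"

definition shuffling_radius_sq ::
    "nat \<Rightarrow> (nat \<Rightarrow> 'a::euclidean_space \<Rightarrow> real) \<Rightarrow> 'a \<Rightarrow> real \<Rightarrow> real" where
  "shuffling_radius_sq n f xs \<gamma> =
     (if n \<le> 1 then 0
      else MAX i\<in>{1..n-1}. 1 / \<gamma>\<^sup>2 *
        measure_pmf.expectation (pmf_of_set (permutations_of_set {1..n}))
          (\<lambda>p. bregman (f (p ! i)) (x_iter f xs \<gamma> p i) xs))"

definition gradient_variance ::
    "nat \<Rightarrow> (nat \<Rightarrow> 'a::euclidean_space \<Rightarrow> real) \<Rightarrow> 'a \<Rightarrow> real" where
  "gradient_variance n f xs =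
     1 / real n * (\<Sum>i=1..n. (norm (gradient (f i) xs - gradient (average_fun n f) xs))\<^sup>2)"

end

theory Submission
  imports Defs
begin

text \<open>
  Smoothness bounds each Bregman divergence by \<open>L / 2\<close> times the squared norm of
  \<open>\<gamma>\<close> times a sum of \<open>i\<close> gradients drawn without replacement. If the
  gradients have mean \<open>m\<close> and variance \<open>\<sigma>\<^sup>2\<close>, the squared norm of that sum has
  expectation \<open>i\<^sup>2 \<parallel>m\<parallel>\<^sup>2 + i (n - i) / (n - 1) \<sigma>\<^sup>2\<close>, and
  for \<open>n \<ge> 2\<close> one has \<open>i (n - i) \<le> n\<^sup>2 / 4 \<le> n (n - 1) / 2\<close>.
\<close>

section \<open>Gradients\<close>

text \<open>A derivative is unique, and its inner products with all vectors determine a vector, so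
  the definite description in \<open>gradient\<close> picks out exactly \<open>g\<close>.\<close>

lemma gradient_eqI:
  assumes "GDERIV \<phi> x :> g"
  shows "gradient \<phi> x = g"
  unfolding gradient_def
proof (rule the_equality)
  fix h assume "GDERIV \<phi> x :> h"
  with assms have "(\<lambda>v. v \<bullet> g) = (\<lambda>v. v \<bullet> h)"
    unfolding gderiv_def by (rule has_derivative_unique)
  then show "h = g"
    by (metis vector_eq_ldot)
qed (fact assms)

text \<open>Riesz representation: a linear functional \<open>D\<close> is the inner product with the
  image of 1 under its adjoint.\<close>

lemma differentiable_imp_GDERIV_gradient:
  fixes \<phi> :: "'a::euclidean_space \<Rightarrow> real"
  assumes "\<phi> differentiable (at x)"
  shows "GDERIV \<phi> x :> gradient \<phi> x"
proof -
  obtain D where D: "(\<phi> has_derivative D) (at x)"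
    using assms by (auto simp: differentiable_def)
  have "D = (\<lambda>v. v \<bullet> adjoint D 1)"
    using adjoint_works[OF has_derivative_linear[OF D], of _ 1] by auto
  with D have "GDERIV \<phi> x :> adjoint D 1"
    by (simp add: gderiv_def)
  then show ?thesis
    using gradient_eqI by metis
qed

lemma gradient_average_fun:
  fixes f :: "nat \<Rightarrow> 'a::euclidean_space \<Rightarrow> real"
  assumes "\<And>i. i \<in> {1..n} \<Longrightarrow> f i differentiable (at x)"
  shows "gradient (average_fun n f) x = (1 / real n) *\<^sub>R (\<Sum>i=1..n. gradient (f i) x)"
proof (rule gradient_eqI)
  have "((\<lambda>y. \<Sum>i=1..n. f i y) has_derivative (\<lambda>h. \<Sum>i=1..n. h \<bullet> gradient (f i) x)) (at x)"
    using differentiable_imp_GDERIV_gradient[OF assms]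
    by (intro has_derivative_sum) (auto simp: gderiv_def)
  then have "((\<lambda>y. 1 / real n * (\<Sum>i=1..n. f i y)) has_derivative
      (\<lambda>h. 1 / real n * (\<Sum>i=1..n. h \<bullet> gradient (f i) x))) (at x)"
    by (rule has_derivative_mult_right)
  then show "GDERIV (average_fun n f) x :> (1 / real n) *\<^sub>R (\<Sum>i=1..n. gradient (f i) x)"
    unfolding gderiv_def average_fun_def[abs_def] by (simp add: inner_sum_right)
qed

section \<open>Sampling without replacement\<close>

text \<open>Exchangeability of positions: swapping two entries is an involution on the permutations
  of \<open>A\<close>, so it only reorders the summands.\<close>

lemma sum_permutations_of_set_transpose:
  assumes "j < card A" "k < card A"
  shows "(\<Sum>p\<in>permutations_of_set A. F (permute_list (Transposition.transpose j k) p)) =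
    (\<Sum>p\<in>permutations_of_set A. F p)"
proof (rule sum.reindex_bij_witness[where i = "permute_list (Transposition.transpose j k)"
      and j = "permute_list (Transposition.transpose j k)"])
  fix p assume p: "p \<in> permutations_of_set A"
  have perm: "Transposition.transpose j k permutes {..<length p}"
    using assms length_finite_permutations_of_set[OF p] by (intro permutes_swap_id) auto
  show "permute_list (Transposition.transpose j k) (permute_list (Transposition.transpose j k) p) = p"
    using permute_list_compose[OF perm, of "Transposition.transpose j k"] by simp
  \<comment> \<open>The swap is its own inverse, so the reindexing rule poses each obligation
    twice.\<close>
  then show "permute_list (Transposition.transpose j k) (permute_list (Transposition.transpose j k) p) = p" .
  show "permute_list (Transposition.transpose j k) p \<in> permutations_of_set A"
    using perm permutations_of_setD[OF p] by auto
  then show "permute_list (Transposition.transpose j k) p \<in> permutations_of_set A" .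
qed simp

lemma sum_permutation_nth:
  assumes "p \<in> permutations_of_set A"
  shows "(\<Sum>l<card A. h (p ! l)) = sum h A"
proof -
  have "bij_betw (\<lambda>l. p ! l) {..<card A} A"
    using permutations_of_setD[OF assms] length_finite_permutations_of_set[OF assms]
    by (auto intro!: bij_betw_nth)
  then show ?thesis
    by (rule sum.reindex_bij_betw)
qed

text \<open>By exchangeability every position contributes the same total, and summing over all
  positions gives \<open>sum h A\<close> for each single permutation.\<close>

lemma sum_permutations_of_set_nth:
  fixes h :: "'a \<Rightarrow> real"
  assumes "j < card A"
  shows "card A * (\<Sum>p\<in>permutations_of_set A. h (p ! j)) = fact (card A) * sum h A"
proof -
  let ?P = "permutations_of_set A"
  \<comment> \<open>An infinite set has \<open>card\<close> 0, which \<open>j < card A\<close> rules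
    out.\<close>
  have "finite A"
    using assms card.infinite by fastforce
  have same: "(\<Sum>p\<in>?P. h (p ! l)) = (\<Sum>p\<in>?P. h (p ! j))" if l: "l < card A" for l
  proof -
    have "(\<Sum>p\<in>?P. h (p ! l)) = (\<Sum>p\<in>?P. h (permute_list (Transposition.transpose j l) p ! j))"
    proof (rule sum.cong)
      fix p assume p: "p \<in> ?P"
      have "Transposition.transpose j l permutes {..<length p}"
        using assms l length_finite_permutations_of_set[OF p] by (intro permutes_swap_id) auto
      then show "h (p ! l) = h (permute_list (Transposition.transpose j l) p ! j)"
        using assms length_finite_permutations_of_set[OF p] by (simp add: permute_list_nth)
    qed simp
    also have "\<dots> = (\<Sum>p\<in>?P. h (p ! j))"
      by (rule sum_permutations_of_set_transpose[OF assms l])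
    finally show ?thesis .
  qed
  have "card A * (\<Sum>p\<in>?P. h (p ! j)) = (\<Sum>l<card A. \<Sum>p\<in>?P. h (p ! l))"
    using same by simp
  also have "\<dots> = (\<Sum>p\<in>?P. \<Sum>l<card A. h (p ! l))"
    by (rule sum.swap)
  also have "\<dots> = (\<Sum>p\<in>?P. sum h A)"
    by (intro sum.cong sum_permutation_nth refl)
  also have "\<dots> = fact (card A) * sum h A"
    using \<open>finite A\<close> by simp
  finally show ?thesis .
qed

text \<open>For fixed \<open>j\<close> all \<open>k \<noteq> j\<close> contribute equally, and the whole sum over \<open>k\<close> is constant.\<close>

lemma sum_permutations_of_set_inner_nth:
  fixes g :: "'a \<Rightarrow> 'b::real_inner"
  assumes "j < card A" "k < card A" "j \<noteq> k"
  shows "card A * (card A - 1) * (\<Sum>p\<in>permutations_of_set A. g (p ! j) \<bullet> g (p ! k)) =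
    fact (card A) * ((norm (sum g A))\<^sup>2 - (\<Sum>a\<in>A. (norm (g a))\<^sup>2))"
proof -
  let ?P = "permutations_of_set A"
  have same: "(\<Sum>p\<in>?P. g (p ! j) \<bullet> g (p ! l)) = (\<Sum>p\<in>?P. g (p ! j) \<bullet> g (p ! k))"
    if l: "l < card A" "l \<noteq> j" for l
  proof -
    have "(\<Sum>p\<in>?P. g (p ! j) \<bullet> g (p ! l)) =
      (\<Sum>p\<in>?P. g (permute_list (Transposition.transpose k l) p ! j) \<bullet> g (permute_list (Transposition.transpose k l) p ! k))"
    proof (rule sum.cong)
      fix p assume p: "p \<in> ?P"
      \<comment> \<open>This swap carries position \<open>k\<close> to \<open>l\<close> and fixes
        \<open>j\<close>, since \<open>j\<close> differs from both.\<close>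
      have "Transposition.transpose k l permutes {..<length p}"
        using assms l length_finite_permutations_of_set[OF p] by (intro permutes_swap_id) auto
      then show "g (p ! j) \<bullet> g (p ! l) =
          g (permute_list (Transposition.transpose k l) p ! j) \<bullet> g (permute_list (Transposition.transpose k l) p ! k)"
        using assms l length_finite_permutations_of_set[OF p] by (simp add: permute_list_nth)
    qed simp
    also have "\<dots> = (\<Sum>p\<in>?P. g (p ! j) \<bullet> g (p ! k))"
      by (rule sum_permutations_of_set_transpose[OF assms(2) l(1)])
    finally show ?thesis .
  qed
  have "(\<Sum>l\<in>{..<card A} - {j}. \<Sum>p\<in>?P. g (p ! j) \<bullet> g (p ! l)) =
      (\<Sum>l\<in>{..<card A} - {j}. \<Sum>p\<in>?P. g (p ! j) \<bullet> g (p ! k))"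
    by (intro sum.cong refl same) auto
  then have "real (card A - 1) * (\<Sum>p\<in>?P. g (p ! j) \<bullet> g (p ! k)) =
      (\<Sum>l\<in>{..<card A} - {j}. \<Sum>p\<in>?P. g (p ! j) \<bullet> g (p ! l))"
    using assms by simp
  also have "\<dots> = (\<Sum>p\<in>?P. \<Sum>l\<in>{..<card A} - {j}. g (p ! j) \<bullet> g (p ! l))"
    by (rule sum.swap)
  also have "\<dots> = (\<Sum>p\<in>?P. g (p ! j) \<bullet> sum g A - (norm (g (p ! j)))\<^sup>2)"
  proof (rule sum.cong)
    fix p assume p: "p \<in> ?P"
    have "(\<Sum>l\<in>{..<card A} - {j}. g (p ! j) \<bullet> g (p ! l)) =
        g (p ! j) \<bullet> (\<Sum>l<card A. g (p ! l)) - g (p ! j) \<bullet> g (p ! j)"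
      using assms by (simp add: inner_sum_right sum_diff1)
    then show "(\<Sum>l\<in>{..<card A} - {j}. g (p ! j) \<bullet> g (p ! l)) =
        g (p ! j) \<bullet> sum g A - (norm (g (p ! j)))\<^sup>2"
      by (simp add: sum_permutation_nth[OF p] power2_norm_eq_inner)
  qed simp
  finally have "card A * (card A - 1) * (\<Sum>p\<in>?P. g (p ! j) \<bullet> g (p ! k)) =
      card A * (\<Sum>p\<in>?P. g (p ! j) \<bullet> sum g A - (norm (g (p ! j)))\<^sup>2)"
    by (simp add: mult.assoc)
  \<comment> \<open>Only the entry at position \<open>j\<close> is left, so the one-position count
    applies.\<close>
  also have "\<dots> = fact (card A) * (\<Sum>a\<in>A. g a \<bullet> sum g A - (norm (g a))\<^sup>2)"
    by (rule sum_permutations_of_set_nth[OF assms(1)])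
  also have "(\<Sum>a\<in>A. g a \<bullet> sum g A - (norm (g a))\<^sup>2) =
      (norm (sum g A))\<^sup>2 - (\<Sum>a\<in>A. (norm (g a))\<^sup>2)"
    by (simp add: sum_subtractf inner_sum_left power2_norm_eq_inner)
  finally show ?thesis .
qed

text \<open>The diagonal is split off because one-position and two-position terms have different
  averages over the permutations.\<close>

lemma norm_sum_sq_eq_inner:
  fixes v :: "nat \<Rightarrow> 'b::real_inner"
  shows "(norm (\<Sum>j<i. v j))\<^sup>2 =
    (\<Sum>j<i. (norm (v j))\<^sup>2) + (\<Sum>j<i. \<Sum>k\<in>{..<i} - {j}. v j \<bullet> v k)"
proof -
  have "(norm (\<Sum>j<i. v j))\<^sup>2 = (\<Sum>j<i. \<Sum>k<i. v j \<bullet> v k)"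
    by (simp add: power2_norm_eq_inner inner_sum_left inner_sum_right) (rule sum.swap)
  also have "\<dots> = (\<Sum>j<i. v j \<bullet> v j + (\<Sum>k\<in>{..<i} - {j}. v j \<bullet> v k))"
    by (intro sum.cong refl sum.remove) auto
  finally show ?thesis
    by (simp add: sum.distrib power2_norm_eq_inner)
qed

lemma sum_permutations_of_set_norm_sq:
  fixes g :: "'a \<Rightarrow> 'b::real_inner"
  assumes "card A \<ge> 2" "i \<le> card A"
  shows "card A * (card A - 1) * (\<Sum>p\<in>permutations_of_set A. (norm (\<Sum>j<i. g (p ! j)))\<^sup>2) =
    fact (card A) * (i * (real (card A) - i) * (\<Sum>a\<in>A. (norm (g a))\<^sup>2) +
      i * (real i - 1) * (norm (sum g A))\<^sup>2)"
proof -
  let ?P = "permutations_of_set A"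
  let ?n = "real (card A)" and ?Q = "\<Sum>a\<in>A. (norm (g a))\<^sup>2" and ?G = "(norm (sum g A))\<^sup>2"
  have diag: "(\<Sum>p\<in>?P. (norm (g (p ! j)))\<^sup>2) = fact (card A) * ?Q / ?n" if "j < i" for j
    using sum_permutations_of_set_nth[of j A "\<lambda>a. (norm (g a))\<^sup>2"] that assms
    by (simp add: field_simps)
  have offdiag: "(\<Sum>p\<in>?P. g (p ! j) \<bullet> g (p ! k)) = fact (card A) * (?G - ?Q) / (?n * (?n - 1))"
    if "j < i" "k \<in> {..<i} - {j}" for j k
    using sum_permutations_of_set_inner_nth[of j A k g] that assms
    by (simp add: field_simps of_nat_diff)
  have "(\<Sum>p\<in>?P. (norm (\<Sum>j<i. g (p ! j)))\<^sup>2) =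
      (\<Sum>p\<in>?P. \<Sum>j<i. (norm (g (p ! j)))\<^sup>2) +
      (\<Sum>p\<in>?P. \<Sum>j<i. \<Sum>k\<in>{..<i} - {j}. g (p ! j) \<bullet> g (p ! k))"
    by (simp add: norm_sum_sq_eq_inner sum.distrib)
  also have "(\<Sum>p\<in>?P. \<Sum>j<i. (norm (g (p ! j)))\<^sup>2) = (\<Sum>j<i. \<Sum>p\<in>?P. (norm (g (p ! j)))\<^sup>2)"
    by (rule sum.swap)
  also have "\<dots> = i * (fact (card A) * ?Q / ?n)"
    by (simp add: diag)
  also have "(\<Sum>p\<in>?P. \<Sum>j<i. \<Sum>k\<in>{..<i} - {j}. g (p ! j) \<bullet> g (p ! k)) =
      (\<Sum>j<i. \<Sum>k\<in>{..<i} - {j}. \<Sum>p\<in>?P. g (p ! j) \<bullet> g (p ! k))"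
    by (subst sum.swap, intro sum.cong refl, rule sum.swap)
  also have "\<dots> = (\<Sum>j<i. \<Sum>k\<in>{..<i} - {j}. fact (card A) * (?G - ?Q) / (?n * (?n - 1)))"
    by (intro sum.cong refl offdiag) auto
  \<comment> \<open>Each inner index set has \<open>i - 1\<close> elements. The case
    \<open>i = 0\<close>, where natural and real subtraction disagree, is harmless because the
    factor \<open>i\<close> vanishes.\<close>
  also have "\<dots> = i * (real i - 1) * (fact (card A) * (?G - ?Q) / (?n * (?n - 1)))"
    by (cases i) (simp_all add: algebra_simps)
  finally have eq: "(\<Sum>p\<in>?P. (norm (\<Sum>j<i. g (p ! j)))\<^sup>2) =
      i * (fact (card A) * ?Q / ?n) +
      i * (real i - 1) * (fact (card A) * (?G - ?Q) / (?n * (?n - 1)))" .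
  have nz: "?n \<noteq> 0" "?n - 1 \<noteq> 0"
    using assms by auto
  have n1: "real (card A * (card A - 1)) = ?n * (?n - 1)"
    using assms by (simp add: of_nat_diff)
  show ?thesis
    unfolding n1 eq using nz by (simp add: field_simps)
qed

text \<open>Expand the square: as \<open>m\<close> is the mean, the cross terms add up to minus
  twice \<open>card A * (norm m)\<^sup>2\<close>.\<close>

lemma sum_norm_sq_deviation:
  fixes g :: "'a \<Rightarrow> 'b::real_inner"
  assumes "sum g A = real (card A) *\<^sub>R m"
  shows "(\<Sum>a\<in>A. (norm (g a - m))\<^sup>2) = (\<Sum>a\<in>A. (norm (g a))\<^sup>2) - card A * (norm m)\<^sup>2"
proof -
  have "(\<Sum>a\<in>A. (norm (g a - m))\<^sup>2) = (\<Sum>a\<in>A. (norm (g a))\<^sup>2 - 2 * (g a \<bullet> m) + (norm m)\<^sup>2)"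
    by (simp add: power2_norm_eq_inner inner_diff inner_commute algebra_simps)
  also have "\<dots> = (\<Sum>a\<in>A. (norm (g a))\<^sup>2) - 2 * (sum g A \<bullet> m) + card A * (norm m)\<^sup>2"
    by (simp add: sum.distrib sum_subtractf inner_sum_left sum_distrib_left)
  finally show ?thesis
    by (simp add: assms power2_norm_eq_inner)
qed

text \<open>Divide the count over all permutations by their number, then trade the raw second moment
  for the variance. The factor \<open>(card A - i) / (card A - 1)\<close> is the finite population
  correction.\<close>

lemma expectation_norm_sum_without_replacement:
  fixes g :: "'a \<Rightarrow> 'b::real_inner"
  assumes "card A \<ge> 2" "i \<le> card A" and m: "sum g A = real (card A) *\<^sub>R m"
  shows "measure_pmf.expectation (pmf_of_set (permutations_of_set A))
      (\<lambda>p. (norm (\<Sum>j<i. g (p ! j)))\<^sup>2) =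
    (real i)\<^sup>2 * (norm m)\<^sup>2 +
      i * (real (card A) - i) / (real (card A) - 1) * (1 / card A * (\<Sum>a\<in>A. (norm (g a - m))\<^sup>2))"
    (is "?E = _")
proof -
  have fin: "finite A"
    using assms(1) card.infinite by fastforce
  let ?n = "real (card A)" and ?Q = "\<Sum>a\<in>A. (norm (g a))\<^sup>2" and ?M = "(norm m)\<^sup>2"
  have nz: "?n \<noteq> 0" "?n - 1 \<noteq> 0"
    using assms by auto
  have n1: "real (card A * (card A - 1)) = ?n * (?n - 1)"
    using assms by (simp add: of_nat_diff)
  have G: "(norm (sum g A))\<^sup>2 = ?n\<^sup>2 * ?M"
    by (simp add: m power_mult_distrib)
  have "?E = (\<Sum>p\<in>permutations_of_set A. (norm (\<Sum>j<i. g (p ! j)))\<^sup>2) / fact (card A)"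
    using fin by (subst integral_pmf_of_set) simp_all
  then have S: "(\<Sum>p\<in>permutations_of_set A. (norm (\<Sum>j<i. g (p ! j)))\<^sup>2) = fact (card A) * ?E"
    by simp
  have "fact (card A) * (?n * (?n - 1) * ?E) =
      fact (card A) * (i * (?n - i) * ?Q + i * (real i - 1) * (?n\<^sup>2 * ?M))"
    using sum_permutations_of_set_norm_sq[OF assms(1,2), of g] unfolding n1 G S
    by (simp only: mult.left_commute)
  then have "?n * (?n - 1) * ?E = i * (?n - i) * ?Q + i * (real i - 1) * (?n\<^sup>2 * ?M)"
    by simp
  \<comment> \<open>The coefficients of \<open>?M\<close> agree because
    \<open>(n - 1) * i - (n - i) = n * (i - 1)\<close>, where \<open>n\<close> stands for
    \<open>?n\<close>.\<close>
  also have "\<dots> = ?n * (?n - 1) * ((real i)\<^sup>2 * ?M +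
      i * (?n - i) / (?n - 1) * (1 / ?n * (?Q - ?n * ?M)))"
    using nz by (simp add: field_simps power2_eq_square)
  finally show ?thesis
    using nz by (simp add: sum_norm_sq_deviation[OF m])
qed

section \<open>The shuffling radius\<close>

text \<open>The displacement \<open>x_iter f xs \<gamma> p i - xs\<close> is
  \<open>-\<gamma>\<close> times the gradient sum. Passing from \<open>L\<close> to \<open>M\<close>
  frees the constant from the random index \<open>p ! i\<close>.\<close>

lemma bregman_x_iter_le:
  assumes "L_smooth L (f (p ! i))" "L \<le> M"
  shows "bregman (f (p ! i)) (x_iter f xs \<gamma> p i) xs
    \<le> M / 2 * \<gamma>\<^sup>2 * (norm (\<Sum>j<i. gradient (f (p ! j)) xs))\<^sup>2"
proof -
  have "bregman (f (p ! i)) (x_iter f xs \<gamma> p i) xs \<le> L / 2 * (norm (x_iter f xs \<gamma> p i - xs))\<^sup>2"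
    using assms(1) by (simp add: L_smooth_def)
  also have "\<dots> \<le> M / 2 * (norm (x_iter f xs \<gamma> p i - xs))\<^sup>2"
    using assms(2) by (intro mult_right_mono) auto
  also have "\<dots> = M / 2 * \<gamma>\<^sup>2 * (norm (\<Sum>j<i. gradient (f (p ! j)) xs))\<^sup>2"
    by (simp add: x_iter_def power_mult_distrib)
  finally show ?thesis .
qed

text \<open>Combine \<open>(n - 2 * i)\<^sup>2 \<ge> 0\<close> with
  \<open>n \<le> 2 * (n - 1)\<close>.\<close>

lemma without_replacement_coefficient_le:
  fixes n i :: real
  assumes "n \<ge> 2"
  shows "i * (n - i) / (n - 1) \<le> n / 2"
proof -
  have "4 * (i * (n - i)) \<le> n\<^sup>2"
    using zero_le_power2[of "n - 2 * i"] by (simp add: power2_eq_square algebra_simps)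
  moreover have "n\<^sup>2 \<le> n * (2 * (n - 1))"
    using assms unfolding power2_eq_square by (intro mult_left_mono) auto
  ultimately show ?thesis
    using assms by (simp add: divide_simps algebra_simps)
qed

theorem theorem1:
  fixes n :: nat
    and f :: "nat \<Rightarrow> real ^ 'd \<Rightarrow> real"
    and L :: "nat \<Rightarrow> real"
    and \<psi> :: "real ^ 'd \<Rightarrow> ereal"
    and xs :: "real ^ 'd"
    and \<gamma> :: real
  assumes "n \<ge> 1"
    and "\<And>i. i \<in> {1..n} \<Longrightarrow> convex_on UNIV (f i)"
    and "\<And>i. i \<in> {1..n} \<Longrightarrow> L i > 0"
    and "\<And>i. i \<in> {1..n} \<Longrightarrow> L_smooth (L i) (f i)"
    and "proper_fun \<psi>" and "closed_fun \<psi>" and "convex_fun \<psi>"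
    and "is_solution (average_fun n f) \<psi> xs"
    and "\<gamma> > 0"
  shows "shuffling_radius_sq n f xs \<gamma>
    \<le> (MAX i\<in>{1..n}. L i) / 2 * real n *
      (real n * (norm (gradient (average_fun n f) xs))\<^sup>2 + 1 / 2 * gradient_variance n f xs)"
proof -
  define M where "M = (MAX i\<in>{1..n}. L i)"
  define m where "m = gradient (average_fun n f) xs"
  define V where "V = gradient_variance n f xs"
  define g where "g = (\<lambda>i. gradient (f i) xs)"
  let ?B = "M / 2 * real n * (real n * (norm m)\<^sup>2 + 1 / 2 * V)"
  have LM: "L i \<le> M" if "i \<in> {1..n}" for i
    unfolding M_def using that by (intro Max_ge) auto
  \<comment> \<open>Index 1 is available because \<open>n \<ge> 1\<close>; it makes the maximum
    nonnegative.\<close>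
  have "0 < L 1" "L 1 \<le> M"
    using assms(1,3) LM by auto
  then have M: "M \<ge> 0"
    by linarith
  have V: "V = 1 / real n * (\<Sum>a\<in>{1..n}. (norm (g a - m))\<^sup>2)"
    by (simp add: V_def gradient_variance_def g_def m_def)
  have V0: "V \<ge> 0"
    unfolding V by (intro mult_nonneg_nonneg sum_nonneg) auto
  \<comment> \<open>This identifies \<open>m\<close> as the mean of the vectors \<open>g i\<close>,
    as the sampling formula requires.\<close>
  have m: "sum g {1..n} = real (card {1..n}) *\<^sub>R m"
    using assms(1,4) gradient_average_fun[of n f xs] by (simp add: m_def g_def L_smooth_def)
  have bound: "1 / \<gamma>\<^sup>2 * measure_pmf.expectation (pmf_of_set (permutations_of_set {1..n}))
        (\<lambda>p. bregman (f (p ! i)) (x_iter f xs \<gamma> p i) xs) \<le> ?B"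
    (is "1 / \<gamma>\<^sup>2 * measure_pmf.expectation ?\<pi> ?D \<le> ?B")
    if n: "n \<ge> 2" and i: "i \<in> {1..n-1}" for i
  proof -
    let ?S = "\<lambda>p. (norm (\<Sum>j<i. g (p ! j)))\<^sup>2"
    \<comment> \<open>There are only finitely many permutations, so every function on them is
      integrable.\<close>
    have int: "integrable (measure_pmf ?\<pi>) h" for h :: "nat list \<Rightarrow> real"
      by (intro integrable_measure_pmf_finite) simp
    have "measure_pmf.expectation ?\<pi> ?D \<le> measure_pmf.expectation ?\<pi> (\<lambda>p. M / 2 * \<gamma>\<^sup>2 * ?S p)"
    proof (rule integral_mono_AE[OF int int], rule AE_pmfI)
      fix p assume "p \<in> set_pmf ?\<pi>"
      then have p: "p \<in> permutations_of_set {1..n}"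
        by simp
      have "p ! i \<in> set p"
        using length_finite_permutations_of_set[OF p] i by (intro nth_mem) auto
      then have "p ! i \<in> {1..n}"
        using permutations_of_setD(1)[OF p] by simp
      then show "?D p \<le> M / 2 * \<gamma>\<^sup>2 * ?S p"
        unfolding g_def using assms(4) LM by (intro bregman_x_iter_le)
    qed
    also have "\<dots> = M / 2 * \<gamma>\<^sup>2 * measure_pmf.expectation ?\<pi> ?S"
      by simp
    finally have "1 / \<gamma>\<^sup>2 * measure_pmf.expectation ?\<pi> ?D
        \<le> M / 2 * measure_pmf.expectation ?\<pi> ?S"
      using assms(9) by (simp add: field_simps)
    also have "measure_pmf.expectation ?\<pi> ?S =
        (real i)\<^sup>2 * (norm m)\<^sup>2 + i * (real n - i) / (real n - 1) * V"
    proof -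
      have "card {1..n} \<ge> 2" "i \<le> card {1..n}"
        using n i by auto
      from expectation_norm_sum_without_replacement[OF this m] show ?thesis
        by (simp add: V)
    qed
    \<comment> \<open>The mean term uses \<open>i \<le> n\<close>; the variance term uses the
      coefficient bound together with \<open>V \<ge> 0\<close>.\<close>
    also have "M / 2 * \<dots> \<le> M / 2 * ((real n)\<^sup>2 * (norm m)\<^sup>2 + real n / 2 * V)"
      using M V0 n i without_replacement_coefficient_le[of "real n" "real i"]
      by (intro mult_left_mono add_mono mult_right_mono power_mono) auto
    also have "\<dots> = ?B"
      by (simp add: algebra_simps power2_eq_square)
    finally show ?thesis .
  qed
  have "shuffling_radius_sq n f xs \<gamma> \<le> ?B"
  proof (cases "n \<le> 1")
    case True
    \<comment> \<open>Here the radius is 0 by convention, so it remains that \<open>?B\<close> is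
      nonnegative.\<close>
    then show ?thesis
      using M V0 by (simp add: shuffling_radius_sq_def)
  next
    case False
    then show ?thesis
      unfolding shuffling_radius_sq_def if_not_P[OF False]
    \<comment> \<open>Bounding a maximum elementwise also requires a finite nonempty set;
      nonemptiness of \<open>{1..n-1}\<close> comes from \<open>n \<ge> 2\<close>.\<close>
    proof (intro Max.boundedI)
      fix a assume "a \<in> (\<lambda>i. 1 / \<gamma>\<^sup>2 *
          measure_pmf.expectation (pmf_of_set (permutations_of_set {1..n}))
            (\<lambda>p. bregman (f (p ! i)) (x_iter f xs \<gamma> p i) xs)) ` {1..n-1}"
      then show "a \<le> ?B"
        using bound False by force
    qed (use False in auto)
  qed
  then show ?thesis
    by (simp only: M_def m_def V_def)
qed

end
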